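(* Let $d$ be an integer with $d\ge 4$. (i) If $d$ is even, $n\ge 4d+1$ and $n\equiv 0\pmod 2$, then $\gamma^{SID}(C_n(1,d))=\frac n2$. (ii) If $n\ge 4d+1$ and $n\equiv 0\pmod 2$, then $\gamma^{SID}(C_n(1,d-1,d))=\frac n2$. (iii) If $d\equiv 1\pmod 3$, $n\ge 4d+5$ and $n\equiv 0\pmod 3$, then $\gamma^{SID}(C_n(1,d-1,d,d+1))=\frac n3$.
   Context: All graphs are simple and undirected. For a graph $G=(V,E)$ and $u\in V$, $N[u]=\{u\}\cup\{v: uv\in E\}$. A code is a nonempty $C\subseteq V$, and $I(C;u)=N[u]\cap C$. $C$ is self-identifying if $I(C;u)\setminus I(C;v)\neq\emptyset$ for all distinct $u,v\in V$. $\gamma^{SID}(G)$ is the minimum cardinality of a self-identifying code in a finite graph $G$. For positive integers $n$ and $d_1,\dots,d_k\le n/2$, the circulant graph $C_n(d_1,\dots,d_k)$ has vertex set $\mathbb{Z}_n$, and the open neighbourhood of $u$ is $\{u\pm d_1,\dots,u\pm d_k\}$ modulo $n$. *)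

theory Defs
  imports Complex_Main "HOL-Library.Extended_Nat"
begin

type_synonym 'a ugraph = "'a set \<times> 'a set set"

definition simple_graph :: "'a ugraph \<Rightarrow> bool" where
  "simple_graph G \<longleftrightarrow>
     (\<forall>e\<in>snd G. \<exists>u\<in>fst G. \<exists>v\<in>fst G. u \<noteq> v \<and> e = {u, v})"

definition open_nbhd :: "'a ugraph \<Rightarrow> 'a \<Rightarrow> 'a set" where
  "open_nbhd G u = {v \<in> fst G. {u, v} \<in> snd G}"

definition closed_nbhd :: "'a ugraph \<Rightarrow> 'a \<Rightarrow> 'a set" where
  "closed_nbhd G u = {u} \<union> open_nbhd G u"

definition is_code :: "'a ugraph \<Rightarrow> 'a set \<Rightarrow> bool" where
  "is_code G C \<longleftrightarrow> C \<noteq> {} \<and> C \<subseteq> fst G"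

definition I_set :: "'a ugraph \<Rightarrow> 'a set \<Rightarrow> 'a \<Rightarrow> 'a set" where
  "I_set G C u = closed_nbhd G u \<inter> C"

definition self_identifying :: "'a ugraph \<Rightarrow> 'a set \<Rightarrow> bool" where
  "self_identifying G C \<longleftrightarrow> is_code G C \<and>
     (\<forall>u\<in>fst G. \<forall>v\<in>fst G. u \<noteq> v \<longrightarrow> I_set G C u - I_set G C v \<noteq> {})"

text \<open>Meant for finite graphs. The value is \<open>\<infinity>\<close> exactly when the graph has no
  self-identifying code; otherwise the infimum is attained, so an equation
  \<open>gamma_SID G = enat k\<close> includes the existence of a code of size \<open>k\<close>.\<close>

definition gamma_SID :: "'a ugraph \<Rightarrow> enat" where
  "gamma_SID G = (INF C \<in> {C. self_identifying G C}. enat (card C))"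

text \<open>The residues modulo \<open>n\<close> are represented by \<open>0, \<dots>, n - 1\<close>. The distances in \<open>D\<close> are
  meant to be positive and at most \<open>n / 2\<close>.\<close>

definition circulant :: "nat \<Rightarrow> nat set \<Rightarrow> int ugraph" where
  "circulant n D =
     ({0..<int n},
      {{u, v} |u v. u \<in> {0..<int n} \<and>
         (\<exists>d\<in>D. v = (u + int d) mod int n \<or> v = (u - int d) mod int n)})"

lemma circulant_step_sym:
  fixes u v d m :: int
  assumes "0 \<le> u" "u < m"
  shows "v = (u + d) mod m \<Longrightarrow> u = (v - d) mod m"
    and "v = (u - d) mod m \<Longrightarrow> u = (v + d) mod m"
  using assms by (simp_all add: mod_simps)

lemma circulant_step_neq:
  fixes u d m :: int
  assumes "0 \<le> u" "u < m" "0 < d" "2 * d \<le> m"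
  shows "(u + d) mod m \<noteq> u" "(u - d) mod m \<noteq> u"
proof -
  have "\<not> m dvd d"
    using assms zdvd_not_zless by force
  moreover have "m dvd d" if "(u + d) mod m = u"
    using that assms by (metis add_diff_cancel_left' dvd_minus_mod)
  moreover have "m dvd d" if "(u - d) mod m = u"
  proof -
    have "m dvd (u - d) - u" using that by (metis dvd_minus_mod minus_diff_eq dvd_minus_iff)
    then show ?thesis by simp
  qed
  ultimately show "(u + d) mod m \<noteq> u" "(u - d) mod m \<noteq> u" by blast+
qed

lemma open_nbhd_circulant:
  assumes "u \<in> {0..<int n}"
  shows "open_nbhd (circulant n D) u =
           (\<Union>d\<in>D. {(u + int d) mod int n, (u - int d) mod int n})"
    (is "?L = ?R")
proof
  show "?R \<subseteq> ?L"
    using assms by (auto simp: open_nbhd_def circulant_def)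
  show "?L \<subseteq> ?R"
  proof
    fix v assume "v \<in> ?L"
    then have v: "v \<in> {0..<int n}" and
      "\<exists>a b. {u, v} = {a, b} \<and> a \<in> {0..<int n} \<and>
         (\<exists>d\<in>D. b = (a + int d) mod int n \<or> b = (a - int d) mod int n)"
      by (auto simp: open_nbhd_def circulant_def)
    then obtain a b d where ab: "{u, v} = {a, b}" "a \<in> {0..<int n}" and d: "d \<in> D"
      "b = (a + int d) mod int n \<or> b = (a - int d) mod int n"
      by blast
    have a: "0 \<le> a" "a < int n" using ab(2) by auto
    consider "u = a" "v = b" | "u = b" "v = a" using ab(1) by (auto simp: doubleton_eq_iff)
    then show "v \<in> ?R"
      using d circulant_step_sym[OF a] by cases blast+
  qed
qed

lemma simple_graph_circulant:
  assumes "\<forall>d\<in>D. 0 < d \<and> 2 * d \<le> n"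
  shows "simple_graph (circulant n D)"
  unfolding simple_graph_def
proof
  fix e assume "e \<in> snd (circulant n D)"
  then obtain u v d where e: "e = {u, v}" and u: "0 \<le> u" "u < int n" and d: "d \<in> D"
    and v: "v = (u + int d) mod int n \<or> v = (u - int d) mod int n"
    by (auto simp: circulant_def)
  have "0 < int d" "2 * int d \<le> int n" using assms d by force+
  then have "v \<noteq> u" using circulant_step_neq[OF u] v by metis
  moreover have "v \<in> {0..<int n}" using u v by auto
  ultimately show "\<exists>u\<in>fst (circulant n D). \<exists>v\<in>fst (circulant n D). u \<noteq> v \<and> e = {u, v}"
    using e u by (intro bexI[of _ u] bexI[of _ v]) (auto simp: circulant_def)
qed

end

theory Submission
  imports Defs
begin

text \<open>Upper bounds: the multiples of 2 (respectively 3) form a self-identifying code, because the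
  code elements in each closed neighbourhood have a single common neighbour.

  Lower bounds: comparing \<open>u\<close> with an adjacent \<open>v\<close> forces the code to meet \<open>N[u] - N[v]\<close>. In (i)
  this puts two code elements among \<open>u \<plusminus> 1, u \<plusminus> d\<close>, and in (iii) one among three translates of
  \<open>u\<close>; summing over \<open>u\<close> gives the bounds. In (ii) such counting only gives \<open>n / 3\<close>. There, if \<open>x\<close>
  and \<open>x + 1\<close> are both outside the code, then three consecutive vertices centred at \<open>x + d\<close> or at
  \<open>x - d + 1\<close> are all in the code. A discharging argument turns this into: there are at least as
  many cyclically consecutive pairs inside the code as outside it.\<close>

section \<open>Closed neighbourhoods as translates of an integer offset set\<close>

definition circ_offsets :: "nat set \<Rightarrow> int set" where
  "circ_offsets D = insert 0 (int ` D \<union> (\<lambda>d. - int d) ` D)"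

lemma fst_circulant [simp]: "fst (circulant n D) = {0..<int n}"
  by (simp add: circulant_def)

lemma closed_nbhd_circulant:
  assumes "u \<in> {0..<int n}"
  shows "closed_nbhd (circulant n D) u = (\<lambda>s. (u + s) mod int n) ` circ_offsets D"
proof -
  have "u = (u + 0) mod int n" using assms by simp
  then show ?thesis
    using assms
    by (simp add: closed_nbhd_def open_nbhd_circulant circ_offsets_def image_Un image_image) blast
qed

text \<open>Here k is the displacement from u to the vertex it is compared with. A code element u +
  s outside N[u + k] cannot have s - k as an offset, even before reduction modulo n, so no size
  condition on n enters.\<close>

lemma self_identifying_circulantD:
  assumes sid: "self_identifying (circulant n D) C" and n: "0 < n" and k: "\<not> int n dvd k"
  shows "\<exists>s\<in>circ_offsets D. s - k \<notin> circ_offsets D \<and> (u + s) mod int n \<in> C"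
proof -
  define a b where "a = u mod int n" and "b = (u + k) mod int n"
  have ab: "a \<in> {0..<int n}" "b \<in> {0..<int n}" using n by (auto simp: a_def b_def)
  have "a \<noteq> b"
    using k by (auto simp: a_def b_def mod_eq_dvd_iff)
  then obtain w where w: "w \<in> closed_nbhd (circulant n D) a" "w \<in> C"
    "w \<notin> closed_nbhd (circulant n D) b"
    using sid ab unfolding self_identifying_def I_set_def fst_circulant by blast
  then obtain s where s: "s \<in> circ_offsets D" "w = (u + s) mod int n"
    using closed_nbhd_circulant[OF ab(1)] by (auto simp: a_def mod_simps)
  have "s - k \<notin> circ_offsets D"
  proof
    assume "s - k \<in> circ_offsets D"
    moreover have "w = (b + (s - k)) mod int n"
      unfolding s b_def by (simp add: mod_simps)
    ultimately show False using w(3) closed_nbhd_circulant[OF ab(2)] by blast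
  qed
  then show ?thesis using s w(2) by blast
qed

section \<open>Upper bounds: the code of multiples of m\<close>

lemma card_multiples_below:
  assumes "0 < m"
  shows "card {x \<in> {0..<int (m * q)}. int m dvd x} = q"
proof -
  have "{x \<in> {0..<int (m * q)}. int m dvd x} = (\<lambda>i. int m * i) ` {0..<int q}"
    using assms by (auto simp: dvd_def zero_le_mult_iff image_iff)
  moreover have "inj_on (\<lambda>i. int m * i) {0..<int q}"
    using assms by (auto simp: inj_on_def)
  ultimately show ?thesis by (simp add: card_image)
qed

lemma offset_difference_eq:
  fixes N :: int
  assumes "N dvd s - t - k" "N dvd s' - t' - k" "\<bar>(s - s') - (t - t')\<bar> < N"
  shows "t - t' = s - s'"
proof -
  have "N dvd (s - s') - (t - t')"
    using dvd_diff[OF assms(1,2)] by (simp add: algebra_simps)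
  then show ?thesis using assms(3) dvd_imp_le_int[of "(s - s') - (t - t')" N] by fastforce
qed

text \<open>Reduces the problem on residues to the integer condition \<open>sep\<close>. If every
  code element of N[u] lies in N[v], each offset s is congruent to some t + (v - u). The bound 4|s|
  < n keeps any combination of four offsets below n, so all these s - t are one and the same integer
  j.\<close>

lemma self_identifying_circulant_multiples:
  assumes n: "0 < n" and dvd: "m dvd n"
    and small: "\<And>s. s \<in> circ_offsets D \<Longrightarrow> 4 * \<bar>s\<bar> < int n"
    and sep: "\<And>u j. (\<And>s. s \<in> circ_offsets D \<Longrightarrow> int m dvd u + s \<Longrightarrow> s - j \<in> circ_offsets D)
                \<Longrightarrow> j = 0"
  shows "self_identifying (circulant n D) {x \<in> {0..<int n}. int m dvd x}"
    (is "self_identifying _ ?C")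
proof -
  have "I_set (circulant n D) ?C u - I_set (circulant n D) ?C v \<noteq> {}"
    if uv: "u \<in> {0..<int n}" "v \<in> {0..<int n}" "u \<noteq> v" for u v
  proof
    assume sub: "I_set (circulant n D) ?C u - I_set (circulant n D) ?C v = {}"
    have cov: "\<exists>t\<in>circ_offsets D. int n dvd s - t - (v - u)"
      if s: "s \<in> circ_offsets D" "int m dvd u + s" for s
    proof -
      have "int m dvd (u + s) mod int n"
        using s(2) dvd by (simp add: dvd_mod)
      then have "(u + s) mod int n \<in> I_set (circulant n D) ?C u"
        using s n uv by (auto simp: I_set_def closed_nbhd_circulant)
      then have "(u + s) mod int n \<in> closed_nbhd (circulant n D) v"
        using sub by (auto simp: I_set_def)
      then obtain t where t: "t \<in> circ_offsets D" "(u + s) mod int n = (v + t) mod int n"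
        using uv by (auto simp: closed_nbhd_circulant)
      then have "int n dvd s - t - (v - u)"
        by (simp add: mod_eq_dvd_iff algebra_simps)
      then show ?thesis using t by blast
    qed
    \<comment> \<open>N[u] meets the code: otherwise the premise of \<open>sep\<close> would hold
      vacuously for j = 1.\<close>
    obtain s where s: "s \<in> circ_offsets D" "int m dvd u + s"
      using sep[of u 1] by auto
    obtain t where t: "t \<in> circ_offsets D" "int n dvd s - t - (v - u)"
      using cov[OF s] by blast
    have "s - t = 0"
    proof (rule sep[of u])
      fix s' assume s': "s' \<in> circ_offsets D" "int m dvd u + s'"
      obtain t' where t': "t' \<in> circ_offsets D" "int n dvd s' - t' - (v - u)"
        using cov[OF s'] by blast
      have "t - t' = s - s'"
        by (rule offset_difference_eq[OF t(2) t'(2)])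
          (use small[OF s(1)] small[OF s'(1)] small[OF t(1)] small[OF t'(1)] in linarith)
      then have "s' - (s - t) = t'" by linarith
      then show "s' - (s - t) \<in> circ_offsets D" using t'(1) by simp
    qed
    then have "int n dvd v - u" using t(2) by (simp add: dvd_diff_commute)
    then have "v mod int n = u mod int n" by (simp add: mod_eq_dvd_iff)
    then show False using uv by simp
  qed
  moreover have "0 \<in> ?C" using n by simp
  ultimately show ?thesis
    unfolding self_identifying_def is_code_def fst_circulant by blast
qed

lemma gamma_SID_circulant_eqI:
  assumes n: "0 < n" and m: "0 < m" and dvd: "m dvd n"
    and lower: "\<And>C. self_identifying (circulant n D) C \<Longrightarrow> int n \<le> int m * int (card C)"
    and small: "\<And>s. s \<in> circ_offsets D \<Longrightarrow> 4 * \<bar>s\<bar> < int n"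
    and sep: "\<And>u j. (\<And>s. s \<in> circ_offsets D \<Longrightarrow> int m dvd u + s \<Longrightarrow> s - j \<in> circ_offsets D)
                \<Longrightarrow> j = 0"
  shows "gamma_SID (circulant n D) = enat (n div m)"
proof (rule antisym)
  obtain q where q: "n = m * q" using dvd by blast
  have "card {x \<in> {0..<int n}. int m dvd x} = n div m"
    using card_multiples_below[OF m, of q] m q by simp
  moreover have "self_identifying (circulant n D) {x \<in> {0..<int n}. int m dvd x}"
    using n dvd small sep by (rule self_identifying_circulant_multiples)
  ultimately show "gamma_SID (circulant n D) \<le> enat (n div m)"
    unfolding gamma_SID_def by (metis (mono_tags, lifting) INF_lower mem_Collect_eq)
  show "enat (n div m) \<le> gamma_SID (circulant n D)"
    unfolding gamma_SID_def
  proof (rule INF_greatest)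
    fix C assume "C \<in> {C. self_identifying (circulant n D) C}"
    then have "int n \<le> int m * int (card C)" using lower by blast
    then have "int m * int q \<le> int m * int (card C)" using q by simp
    then show "enat (n div m) \<le> enat (card C)" using q m by simp
  qed
qed

section \<open>Counting code elements by periodic sums\<close>

lemma sum_periodic_shift:
  fixes g :: "int \<Rightarrow> 'a::comm_monoid_add"
  assumes "0 < N" and per: "\<And>x. g (x mod N) = g x"
  shows "(\<Sum>x\<in>{0..<N}. g (x + a)) = (\<Sum>x\<in>{0..<N}. g x)"
  by (rule sum.reindex_bij_witness[of _ "\<lambda>y. (y - a) mod N" "\<lambda>x. (x + a) mod N"])
    (use assms in \<open>auto simp: mod_simps\<close>)

text \<open>The indicator of C extended periodically to all integers, so that forced code elements
  become inequalities that can be summed over a period.\<close>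

definition code_ind :: "nat \<Rightarrow> int set \<Rightarrow> int \<Rightarrow> int" where
  "code_ind n C x = of_bool (x mod int n \<in> C)"

lemma code_ind_cases: "code_ind n C x = 0 \<or> code_ind n C x = 1"
  by (simp add: code_ind_def)

lemma code_ind_mod [simp]:
  "code_ind n C (x mod int n) = code_ind n C x"
  "code_ind n C (x mod int n + a) = code_ind n C (x + a)"
  "code_ind n C (x mod int n - a) = code_ind n C (x - a)"
  by (simp_all add: code_ind_def mod_simps)

lemma sum_code_ind:
  assumes "self_identifying (circulant n D) C" "0 < n"
  shows "(\<Sum>x\<in>{0..<int n}. code_ind n C (x + a)) = int (card C)"
proof -
  have C: "C \<subseteq> {0..<int n}"
    using assms by (auto simp: self_identifying_def is_code_def circulant_def)
  have "(\<Sum>x\<in>{0..<int n}. code_ind n C (x + a)) = (\<Sum>x\<in>{0..<int n}. code_ind n C x)"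
    using assms by (intro sum_periodic_shift) auto
  also have "\<dots> = (\<Sum>x\<in>{0..<int n}. of_bool (x \<in> C))"
    by (intro sum.cong) (auto simp: code_ind_def)
  also have "\<dots> = int (card C)"
    using C by (simp add: Int_absorb1 Int_def[symmetric] sum.If_cases of_bool_def)
  finally show ?thesis .
qed

lemma self_identifying_code_ind:
  assumes "self_identifying (circulant n D) C" "0 < \<bar>k\<bar>" "\<bar>k\<bar> < int n"
  shows "\<exists>s\<in>circ_offsets D. s - k \<notin> circ_offsets D \<and> code_ind n C (u + s) = 1"
proof -
  have "\<not> int n dvd k" using assms dvd_imp_le_int[of k "int n"] by auto
  then show ?thesis
    using self_identifying_circulantD[OF assms(1), of k u] assms by (auto simp: code_ind_def)
qed

section \<open>The graphs with distances 1, d\<close>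

lemma circulant_1_d_lower:
  assumes d: "4 \<le> d" and n: "4 * d + 1 \<le> n" and sid: "self_identifying (circulant n {1, d}) C"
  shows "int n \<le> 2 * int (card C)"
proof -
  define e where "e = int d"
  define c where "c = code_ind n C"
  have e: "4 \<le> e" "4 * e + 1 \<le> int n" using d n by (auto simp: e_def)
  have offs: "circ_offsets {1, d} = {0, 1, -1, e, -e}"
    by (auto simp: circ_offsets_def e_def)
  note hit = self_identifying_code_ind[OF sid, unfolded offs, folded c_def]
  \<comment> \<open>For each neighbour v of u, N[u] - N[v] lies within the other three neighbours of
    u. Hence no three of the four can all miss the code.\<close>
  have "2 \<le> c (u + 1) + c (u + -1) + c (u + e) + c (u + -e)" for u
  proof -
    have h: "c (u + -1) = 1 \<or> c (u + e) = 1 \<or> c (u + -e) = 1"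
      "c (u + 1) = 1 \<or> c (u + e) = 1 \<or> c (u + -e) = 1"
      "c (u + 1) = 1 \<or> c (u + -1) = 1 \<or> c (u + -e) = 1"
      "c (u + 1) = 1 \<or> c (u + -1) = 1 \<or> c (u + e) = 1"
      using hit[of 1 u] hit[of "-1" u] hit[of e u] hit[of "-e" u] e by auto
    then show ?thesis
      using code_ind_cases[of n C "u + 1", folded c_def] code_ind_cases[of n C "u + -1", folded c_def]
        code_ind_cases[of n C "u + e", folded c_def] code_ind_cases[of n C "u + -e", folded c_def]
      by (smt (verit))
  qed
  then have "(\<Sum>u\<in>{0..<int n}. 2) \<le> (\<Sum>u\<in>{0..<int n}. c (u + 1) + c (u + -1) + c (u + e) + c (u + -e))"
    by (intro sum_mono)
  then show ?thesis
    using sum_code_ind[OF sid, folded c_def] n by (simp only: sum.distrib) simp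
qed

text \<open>Evenness of d puts u + d and u - d in the code for even u; for odd u the pair is u + 1,
  u - 1. In both cases only j = 0 shifts the pair back into the offsets; for the pair 1, -1, the
  bound d \<ge> 4 excludes coincidences such as 1 - d = -2.\<close>

lemma circulant_1_d_separation:
  assumes d: "4 \<le> d" "even d"
    and cov: "\<And>s. s \<in> circ_offsets {1, d} \<Longrightarrow> int 2 dvd u + s \<Longrightarrow> s - j \<in> circ_offsets {1, d}"
  shows "j = 0"
proof -
  define e where "e = int d"
  have e: "4 \<le> e" "even e" using d by (auto simp: e_def)
  have offs: "circ_offsets {1, d} = {0, 1, -1, e, -e}"
    by (auto simp: circ_offsets_def e_def)
  note cov' = cov[unfolded offs]
  show ?thesis
  proof (cases "even u")
    case True
    then show ?thesis using cov'[of e] cov'[of "-e"] e by auto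
  next
    case False
    then show ?thesis using cov'[of 1] cov'[of "-1"] e by auto
  qed
qed

section \<open>The graphs with distances 1, d - 1, d\<close>

lemma circulant_1_d1_d_lower:
  assumes d: "4 \<le> d" and n: "4 * d + 1 \<le> n"
    and sid: "self_identifying (circulant n {1, d - 1, d}) C"
  shows "int n \<le> 2 * int (card C)"
proof -
  define e where "e = int d"
  define c where "c = code_ind n C"
  have e: "4 \<le> e" "4 * e + 1 \<le> int n" using d n by (auto simp: e_def)
  have N: "0 < int n" using e by linarith
  have offs: "circ_offsets {1, d - 1, d} = {0, 1, -1, e - 1, 1 - e, e, -e}"
    using d by (auto simp: circ_offsets_def e_def)
  note hit = self_identifying_code_ind[OF sid, unfolded offs, folded c_def]
  have c01: "c x = 0 \<or> c x = 1" for x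
    unfolding c_def by (rule code_ind_cases)
  \<comment> \<open>\<open>A\<close> forces the centre of at least one triple. The next four facts
    take u = x + e or u = x + 1 - e, both adjacent to x and x + 1, and force the outer vertices of
    both triples.\<close>
  have A: "c x = 1 \<or> c (x + e) = 1 \<or> c (x - e + 1) = 1" for x
    using hit[of 1 "x + 1"] e by (auto simp: algebra_simps)
  have up_out: "c x = 1 \<or> c (x + 1) = 1 \<or> c (x + e + 1) = 1" for x
    using hit[of "e - 1" "x + e"] e by (auto simp: algebra_simps)
  have up_in: "c x = 1 \<or> c (x + 1) = 1 \<or> c (x + e - 1) = 1" for x
    using hit[of e "x + e"] e by (auto simp: algebra_simps)
  have down_in: "c x = 1 \<or> c (x + 1) = 1 \<or> c (x - e + 2) = 1" for x
    using hit[of "-e" "x + 1 - e"] e by (auto simp: algebra_simps)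
  have down_out: "c x = 1 \<or> c (x + 1) = 1 \<or> c (x - e) = 1" for x
    using hit[of "1 - e" "x + 1 - e"] e by (auto simp: algebra_simps)
  txt \<open>A pair \<open>x, x + 1\<close> outside the code has charge 2, sent to the code triple around \<open>x + e\<close>
    (as \<open>\<alpha>\<close>) or around \<open>x - e + 1\<close> (as \<open>\<beta>\<close>), or split evenly if both triples exist.\<close>
  define z where "z x = (1 - c x) * (1 - c (x + 1))" for x
  define t where "t x = c x * c (x + 1)" for x
  define \<alpha> where "\<alpha> x = z x * (1 + c (x + e) - c (x - e + 1))" for x
  define \<beta> where "\<beta> x = z x * (1 - c (x + e) + c (x - e + 1))" for x
  have z_cases: "z x = 0 \<or> z x = 1 \<and> c (x + e - 1) = 1 \<and> c (x + e + 1) = 1 \<and> c (x - e) = 1 \<and>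
      c (x - e + 2) = 1 \<and> (c (x + e) = 1 \<or> c (x - e + 1) = 1)" for x
    using c01[of x] c01[of "x + 1"] A[of x] up_out[of x] up_in[of x] down_in[of x] down_out[of x]
    unfolding z_def by auto
  have shift: "x + 1 + e = x + e + 1" "x + 1 - e + 1 = x - e + 2" "x + 1 + e - 1 = x + e"
    "x + 1 - e = x - e + 1" "x - e + 1 + 1 = x - e + 2" for x
    by auto
  \<comment> \<open>The triples around x + e and x + e + 1 share the pair counted by t (x + e). If
    x, x + 1, x + 2 all miss the code, all four triples are present, so both charges are split and
    add up to 2.\<close>
  have alpha: "\<alpha> x + \<alpha> (x + 1) \<le> 2 * t (x + e)" for x
    using z_cases[of x] z_cases[of "x + 1"] c01[of "x + e"] c01[of "x + e + 1"]
      c01[of "x - e + 1"] c01[of "x - e + 2"]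
    unfolding \<alpha>_def t_def shift by (elim disjE conjE) simp_all
  have beta: "\<beta> x + \<beta> (x + 1) \<le> 2 * t (x - e + 1)" for x
    using z_cases[of x] z_cases[of "x + 1"] c01[of "x + e"] c01[of "x + e + 1"]
      c01[of "x - e + 1"] c01[of "x - e + 2"]
    unfolding \<beta>_def t_def shift by (elim disjE conjE) simp_all
  have per: "t (x mod int n) = t x" "\<alpha> (x mod int n) = \<alpha> x" "\<beta> (x mod int n) = \<beta> x" for x
    unfolding t_def \<alpha>_def \<beta>_def z_def c_def
    by (simp_all only: code_ind_mod diff_add_eq diff_diff_eq2[symmetric])
  let ?S = "\<lambda>g. \<Sum>x\<in>{0..<int n}. g x :: int"
  have "?S (\<lambda>x. \<alpha> x + \<alpha> (x + 1)) \<le> ?S (\<lambda>x. 2 * t (x + e))"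
    using alpha by (intro sum_mono)
  then have 1: "2 * ?S \<alpha> \<le> 2 * ?S t"
    using sum_periodic_shift[of "int n" \<alpha>, OF N per(2)] sum_periodic_shift[of "int n" t, OF N per(1)]
    by (simp add: sum.distrib flip: sum_distrib_left)
  have "?S (\<lambda>x. \<beta> x + \<beta> (x + 1)) \<le> ?S (\<lambda>x. 2 * t (x + (1 - e)))"
    using beta by (intro sum_mono) (simp add: algebra_simps)
  then have 2: "2 * ?S \<beta> \<le> 2 * ?S t"
    using sum_periodic_shift[of "int n" \<beta>, OF N per(3)] sum_periodic_shift[of "int n" t, OF N per(1)]
    by (simp add: sum.distrib flip: sum_distrib_left)
  \<comment> \<open>Pointwise \<alpha> + \<beta> = 2 z and z x - t x = 1 - c x - c (x + 1).\<close>
  have "?S (\<lambda>x. 2 * t x) + ?S (\<lambda>x. 2) = ?S (\<lambda>x. (\<alpha> x + \<beta> x) + 2 * (c (x + 0) + c (x + 1)))"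
    unfolding sum.distrib[symmetric]
    by (intro sum.cong) (auto simp: \<alpha>_def \<beta>_def z_def t_def algebra_simps)
  also have "\<dots> = ?S \<alpha> + ?S \<beta> + 2 * (int (card C) + int (card C))"
    using sum_code_ind[OF sid, folded c_def] n
    by (simp only: sum.distrib sum_distrib_left[symmetric])
  finally show ?thesis
    using 1 2 by (simp flip: sum_distrib_left)
qed

text \<open>By parity, the code contains u + d and u - d, or else u + (d - 1) and u - (d - 1). The
  first pair is extreme and allows no shift; the second allows at most a shift by 1, which would
  need d - 2 or 2 - d as an offset.\<close>

lemma circulant_1_d1_d_separation:
  assumes d: "4 \<le> d"
    and cov: "\<And>s. s \<in> circ_offsets {1, d - 1, d} \<Longrightarrow> int 2 dvd u + s \<Longrightarrow>
                s - j \<in> circ_offsets {1, d - 1, d}"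
  shows "j = 0"
proof -
  define e where "e = int d"
  have e: "4 \<le> e" using d by (auto simp: e_def)
  have offs: "circ_offsets {1, d - 1, d} = {0, 1, -1, e - 1, 1 - e, e, -e}"
    using d by (auto simp: circ_offsets_def e_def)
  note cov' = cov[unfolded offs]
  show ?thesis
  proof (cases "even (u + e)")
    case True
    then show ?thesis using cov'[of e] cov'[of "-e"] e by auto
  next
    case False
    then show ?thesis using cov'[of "e - 1"] cov'[of "1 - e"] e by auto
  qed
qed

section \<open>The graphs with distances 1, d - 1, d, d + 1\<close>

lemma circulant_1_d1_d_d1_lower:
  assumes d: "4 \<le> d" and n: "4 * d + 5 \<le> n"
    and sid: "self_identifying (circulant n {1, d - 1, d, d + 1}) C"
  shows "int n \<le> 3 * int (card C)"
proof -
  define e where "e = int d"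
  define c where "c = code_ind n C"
  have e: "4 \<le> e" "4 * e + 5 \<le> int n" using d n by (auto simp: e_def)
  have offs: "circ_offsets {1, d - 1, d, d + 1} = {0, 1, -1, e - 1, 1 - e, e, -e, e + 1, - e - 1}"
    using d by (auto simp: circ_offsets_def e_def)
  note hit = self_identifying_code_ind[OF sid, unfolded offs, folded c_def]
  \<comment> \<open>The offsets form three separate runs of three consecutive integers; passing from
    u to u + 1 loses exactly the left end of each run.\<close>
  have "1 \<le> c (u + -1) + c (u + (e - 1)) + c (u + (-e - 1))" for u
  proof -
    have "c (u + -1) = 1 \<or> c (u + (e - 1)) = 1 \<or> c (u + (-e - 1)) = 1"
      using hit[of 1 u] e by auto
    then show ?thesis
      using code_ind_cases[of n C "u + -1", folded c_def]
        code_ind_cases[of n C "u + (e - 1)", folded c_def]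
        code_ind_cases[of n C "u + (-e - 1)", folded c_def]
      by (smt (verit))
  qed
  then have "(\<Sum>u\<in>{0..<int n}. 1) \<le> (\<Sum>u\<in>{0..<int n}. c (u + -1) + c (u + (e - 1)) + c (u + (-e - 1)))"
    by (intro sum_mono)
  then show ?thesis
    using sum_code_ind[OF sid, folded c_def] n by (simp only: sum.distrib) simp
qed

text \<open>Each run of three offsets contains exactly one code position, and d mod 3 = 1 determines
  which. The two outer positions confine j to a few values; the middle one leaves only 0.\<close>

lemma circulant_1_d1_d_d1_separation:
  assumes d: "4 \<le> d" "d mod 3 = 1"
    and cov: "\<And>s. s \<in> circ_offsets {1, d - 1, d, d + 1} \<Longrightarrow> int 3 dvd u + s \<Longrightarrow>
                s - j \<in> circ_offsets {1, d - 1, d, d + 1}"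
  shows "j = 0"
proof -
  define e where "e = int d"
  have e: "4 \<le> e" using d by (auto simp: e_def)
  have e3: "e mod 3 = 1" using d(2) by (metis e_def of_nat_1 of_nat_mod of_nat_numeral)
  have offs: "circ_offsets {1, d - 1, d, d + 1} = {0, 1, -1, e - 1, 1 - e, e, -e, e + 1, - e - 1}"
    (is "_ = ?O")
    using d by (auto simp: circ_offsets_def e_def)
  have cov': "s - j \<in> ?O" if "s \<in> ?O" "3 dvd u + s" for s
    using cov[of s] that unfolding offs by simp
  have "u mod 3 = 0 \<or> u mod 3 = 1 \<or> u mod 3 = 2" by presburger
  then consider "u mod 3 = 0" | "u mod 3 = 1" | "u mod 3 = 2" by blast
  then show ?thesis
  proof cases
    case 1
    then have "3 dvd u + 0" "3 dvd u + (e - 1)" "3 dvd u + (1 - e)" using e3 by presburger+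
    then have O: "0 - j \<in> ?O" "e - 1 - j \<in> ?O" "1 - e - j \<in> ?O"
      by (intro cov'; simp)+
    \<comment> \<open>The values 2 and -2 survive only for d = 4, where e - 3 = 1 is an
      offset.\<close>
    have "j = 0 \<or> j = 2 \<or> j = -2" using O(2,3) e by auto
    then show ?thesis using O(1) e by auto
  next
    case 2
    then have "3 dvd u + -1" "3 dvd u + -e" "3 dvd u + (e + 1)" using e3 by presburger+
    then have O: "-1 - j \<in> ?O" "-e - j \<in> ?O" "e + 1 - j \<in> ?O"
      by (intro cov'; simp)+
    have "j = 0 \<or> j = 1" using O(2,3) e by auto
    then show ?thesis using O(1) e by auto
  next
    case 3
    then have "3 dvd u + 1" "3 dvd u + e" "3 dvd u + (- e - 1)" using e3 by presburger+
    then have O: "1 - j \<in> ?O" "e - j \<in> ?O" "- e - 1 - j \<in> ?O"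
      by (intro cov'; simp)+
    have "j = 0 \<or> j = -1" using O(2,3) e by auto
    then show ?thesis using O(1) e by auto
  qed
qed

theorem theorem7:
  fixes d :: nat
  assumes "d \<ge> 4"
  shows "(\<forall>n::nat. even d \<and> n \<ge> 4 * d + 1 \<and> n mod 2 = 0 \<longrightarrow>
            gamma_SID (circulant n {1, d}) = enat (n div 2)) \<and>
         (\<forall>n::nat. n \<ge> 4 * d + 1 \<and> n mod 2 = 0 \<longrightarrow>
            gamma_SID (circulant n {1, d - 1, d}) = enat (n div 2)) \<and>
         (\<forall>n::nat. d mod 3 = 1 \<and> n \<ge> 4 * d + 5 \<and> n mod 3 = 0 \<longrightarrow>
            gamma_SID (circulant n {1, d - 1, d, d + 1}) = enat (n div 3))"
proof (intro conjI allI impI; elim conjE)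
  fix n :: nat
  assume n: "even d" "4 * d + 1 \<le> n" "n mod 2 = 0"
  show "gamma_SID (circulant n {1, d}) = enat (n div 2)"
  proof (rule gamma_SID_circulant_eqI)
    show "4 * \<bar>s\<bar> < int n" if "s \<in> circ_offsets {1, d}" for s
      using that assms n(2) by (auto simp: circ_offsets_def)
    show "j = 0" if "\<And>s. s \<in> circ_offsets {1, d} \<Longrightarrow> int 2 dvd u + s \<Longrightarrow>
        s - j \<in> circ_offsets {1, d}" for u j
      using assms n(1) that by (rule circulant_1_d_separation)
  qed (use circulant_1_d_lower[OF assms n(2)] n in auto)
next
  fix n :: nat
  assume n: "4 * d + 1 \<le> n" "n mod 2 = 0"
  show "gamma_SID (circulant n {1, d - 1, d}) = enat (n div 2)"
  proof (rule gamma_SID_circulant_eqI)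
    show "4 * \<bar>s\<bar> < int n" if "s \<in> circ_offsets {1, d - 1, d}" for s
      using that assms n(1) by (auto simp: circ_offsets_def)
    show "j = 0" if "\<And>s. s \<in> circ_offsets {1, d - 1, d} \<Longrightarrow> int 2 dvd u + s \<Longrightarrow>
        s - j \<in> circ_offsets {1, d - 1, d}" for u j
      using assms that by (rule circulant_1_d1_d_separation)
  qed (use circulant_1_d1_d_lower[OF assms n(1)] n in auto)
next
  fix n :: nat
  assume n: "d mod 3 = 1" "4 * d + 5 \<le> n" "n mod 3 = 0"
  show "gamma_SID (circulant n {1, d - 1, d, d + 1}) = enat (n div 3)"
  proof (rule gamma_SID_circulant_eqI)
    \<comment> \<open>The largest offset is now d + 1, so 4d + 5 is the least n allowed by this
      bound.\<close>
    show "4 * \<bar>s\<bar> < int n" if "s \<in> circ_offsets {1, d - 1, d, d + 1}" for s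
      using that assms n(2) by (auto simp: circ_offsets_def)
    show "j = 0" if "\<And>s. s \<in> circ_offsets {1, d - 1, d, d + 1} \<Longrightarrow> int 3 dvd u + s \<Longrightarrow>
        s - j \<in> circ_offsets {1, d - 1, d, d + 1}" for u j
      using assms n(1) that by (rule circulant_1_d1_d_d1_separation)
  qed (use circulant_1_d1_d_d1_lower[OF assms n(2)] n in auto)
qed

end
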